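(* The quotient $\mathcal{H}_0:=\mathbb{Q}\langle L\rangle/(\mathcal{L}_-+\mathcal{T}_-)$, with the product induced by $\diamond_0$ and the coproduct induced by $\overline{\Delta}_0$ (with unit $\mathbf{1}$ and counit induced by $\varepsilon$), is a commutative Hopf algebra.
   Context: Let $L=\{d,y\}$, $L^*$ the free monoid on $L$ with empty word $\mathbf{1}$, and $\mathbb{Q}\langle L\rangle$ the free associative algebra (concatenation product). Let $\mathcal{T}_-:=\langle wd : w\in L^*\rangle_{\mathbb{Q}}$. The (in general noncommutative and nonassociative) bilinear product $\diamond_0$ on $\mathbb{Q}\langle L\rangle$ is defined recursively on words $u,v,w\in L^*$ by: $\mathbf{1}\diamond_0 w=w\diamond_0\mathbf{1}=w$; $yu\diamond_0 v=u\diamond_0 yv=y(u\diamond_0 v)$; $du\diamond_0 dv=d(u\diamond_0 dv)-u\diamond_0 d^2v$. $\mathcal{L}_-$ is the two-sided ideal of the nonassociative algebra $(\mathbb{Q}\langle L\rangle,\diamond_0)$ (smallest subspace stable under left and right $\diamond_0$-multiplication) generated by all elements $d^k\big(d(u\diamond_0 v)-du\diamond_0 v-u\diamond_0 dv\big)$, $k\in\mathbb{N}_0$, $u,v\in L^*$. The coproduct $\overline{\Delta}_0:\mathbb{Q}\langle L\rangle\to\mathbb{Q}\langle L\rangle\otimes\mathbb{Q}\langle L\rangle$ is the algebra morphism for concatenation with $\overline{\Delta}_0(y)=\mathbf{1}\otimes y+y\otimes\mathbf{1}$, $\overline{\Delta}_0(d)=\mathbf{1}\otimes d+d\otimes\mathbf{1}$.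 The counit is $\varepsilon(\mathbf{1})=1$, $\varepsilon(w)=0$ for $w\in L^*\setminus\{\mathbf{1}\}$. *)

theory Defs
  imports Complex_Main "HOL-Library.Poly_Mapping"
begin

section \<open>Rational vector spaces\<close>

class rat_vector = ab_group_add +
  fixes scaleQ :: "rat \<Rightarrow> 'a \<Rightarrow> 'a" (infixr \<open>*\<^sub>Q\<close> 75)
  assumes scaleQ_add_right: "a *\<^sub>Q (x + y) = a *\<^sub>Q x + a *\<^sub>Q y"
    and scaleQ_add_left: "(a + b) *\<^sub>Q x = a *\<^sub>Q x + b *\<^sub>Q x"
    and scaleQ_scaleQ: "a *\<^sub>Q b *\<^sub>Q x = (a * b) *\<^sub>Q x"
    and scaleQ_one: "1 *\<^sub>Q x = x"

global_interpretation rat_vec: vector_space "scaleQ :: rat \<Rightarrow> 'a \<Rightarrow> 'a::rat_vector"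
  by unfold_locales (simp_all add: scaleQ_add_right scaleQ_add_left scaleQ_scaleQ scaleQ_one)

abbreviation qlinear :: "('a::rat_vector \<Rightarrow> 'b::rat_vector) \<Rightarrow> bool"
  where "qlinear \<equiv> Vector_Spaces.linear scaleQ scaleQ"

definition qbilinear :: "('a::rat_vector \<Rightarrow> 'b::rat_vector \<Rightarrow> 'c::rat_vector) \<Rightarrow> bool"
  where "qbilinear f \<longleftrightarrow> (\<forall>x. qlinear (f x)) \<and> (\<forall>y. qlinear (\<lambda>x. f x y))"

lemma qlinearI:
  assumes "\<And>x y. f (x + y) = f x + f y" "\<And>c x. f (c *\<^sub>Q x) = c *\<^sub>Q f x"
  shows "qlinear f"
  by unfold_locales (simp_all add: assms)

lemma qlinear_add: "qlinear f \<Longrightarrow> f (x + y) = f x + f y"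
  and qlinear_scale: "qlinear f \<Longrightarrow> f (c *\<^sub>Q x) = c *\<^sub>Q f x"
  and qlinear_diff: "qlinear f \<Longrightarrow> f (x - y) = f x - f y"
  and qlinear_zero: "qlinear f \<Longrightarrow> f 0 = 0"
  by (simp_all add: linear_iff_module_hom module_hom.add module_hom.scale
      module_hom.diff module_hom.zero)

lemma qlinear_sum: "qlinear f \<Longrightarrow> f (sum g A) = (\<Sum>x\<in>A. f (g x))"
  by (simp add: linear_iff_module_hom module_hom.sum)

lemma qbilinearI:
  assumes "\<And>x x' y. f (x + x') y = f x y + f x' y" "\<And>c x y. f (c *\<^sub>Q x) y = c *\<^sub>Q f x y"
    and "\<And>x y y'. f x (y + y') = f x y + f x y'" "\<And>c x y. f x (c *\<^sub>Q y) = c *\<^sub>Q f x y"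
  shows "qbilinear f"
  unfolding qbilinear_def by (intro conjI allI qlinearI) (simp_all add: assms)

lemma qbilinearD:
  assumes "qbilinear f"
  shows "qlinear (f x)" "qlinear (\<lambda>x. f x y)"
  using assms by (auto simp: qbilinear_def)

instantiation rat :: rat_vector
begin
definition scaleQ_rat :: "rat \<Rightarrow> rat \<Rightarrow> rat" where [simp]: "scaleQ_rat c x = c * x"
instance by standard (simp_all add: algebra_simps)
end

instantiation poly_mapping :: (type, rat_vector) rat_vector
begin
definition scaleQ_poly_mapping :: "rat \<Rightarrow> ('a \<Rightarrow>\<^sub>0 'b) \<Rightarrow> 'a \<Rightarrow>\<^sub>0 'b"
  where "scaleQ_poly_mapping c = Poly_Mapping.map (scaleQ c)"
lemma lookup_scaleQ [simp]: "Poly_Mapping.lookup (c *\<^sub>Q p) k = c *\<^sub>Q Poly_Mapping.lookup p k"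
  by (simp add: scaleQ_poly_mapping_def map.rep_eq when_def rat_vec.scale_zero_right)
instance
  by standard (auto intro!: poly_mapping_eqI
      simp: lookup_add scaleQ_add_right scaleQ_add_left scaleQ_scaleQ scaleQ_one)
end

lemma scaleQ_single: "c *\<^sub>Q Poly_Mapping.single k x = Poly_Mapping.single k (c *\<^sub>Q x)"
  by (intro poly_mapping_eqI) (simp add: lookup_single when_def)

text \<open>The linear map on the vector space with basis \<^typ>\<open>'k\<close> extending \<open>f\<close>.\<close>

definition lin_ext :: "('k \<Rightarrow> 'v::rat_vector) \<Rightarrow> ('k \<Rightarrow>\<^sub>0 rat) \<Rightarrow> 'v"
  where "lin_ext f p = (\<Sum>k\<in>Poly_Mapping.keys p. Poly_Mapping.lookup p k *\<^sub>Q f k)"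

lemma lin_ext_superset:
  assumes "finite A" "Poly_Mapping.keys p \<subseteq> A"
  shows "lin_ext f p = (\<Sum>k\<in>A. Poly_Mapping.lookup p k *\<^sub>Q f k)"
  unfolding lin_ext_def
  by (rule sum.mono_neutral_left) (use assms in \<open>auto simp: in_keys_iff\<close>)

lemma lin_ext_single [simp]: "lin_ext f (Poly_Mapping.single k c) = c *\<^sub>Q f k"
  by (cases "c = 0") (simp_all add: lin_ext_def)

lemma qlinear_lin_ext [simp]: "qlinear (lin_ext f)"
proof (rule qlinearI)
  fix p q :: "'a \<Rightarrow>\<^sub>0 rat"
  let ?A = "Poly_Mapping.keys p \<union> Poly_Mapping.keys q"
  have "lin_ext f (p + q) = (\<Sum>k\<in>?A. Poly_Mapping.lookup (p + q) k *\<^sub>Q f k)"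
    by (rule lin_ext_superset) (use keys_add[of p q] in auto)
  also have "\<dots> = (\<Sum>k\<in>?A. Poly_Mapping.lookup p k *\<^sub>Q f k) + (\<Sum>k\<in>?A. Poly_Mapping.lookup q k *\<^sub>Q f k)"
    by (simp add: lookup_add scaleQ_add_left sum.distrib)
  also have "\<dots> = lin_ext f p + lin_ext f q"
    by (simp add: lin_ext_superset[of ?A])
  finally show "lin_ext f (p + q) = lin_ext f p + lin_ext f q" .
next
  fix c :: rat and p :: "'a \<Rightarrow>\<^sub>0 rat"
  have "lin_ext f (c *\<^sub>Q p) = (\<Sum>k\<in>Poly_Mapping.keys p. Poly_Mapping.lookup (c *\<^sub>Q p) k *\<^sub>Q f k)"
    by (rule lin_ext_superset) (auto simp: in_keys_iff)
  then show "lin_ext f (c *\<^sub>Q p) = c *\<^sub>Q lin_ext f p"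
    by (simp add: lin_ext_def rat_vec.scale_sum_right scaleQ_scaleQ)
qed

lemma poly_mapping_lin_ext: "p = lin_ext (\<lambda>k. Poly_Mapping.single k 1) p"
proof (rule poly_mapping_eqI)
  fix k
  have "Poly_Mapping.lookup (lin_ext (\<lambda>k. Poly_Mapping.single k 1) p) k =
      (\<Sum>j\<in>Poly_Mapping.keys p. if j = k then Poly_Mapping.lookup p j else 0)"
    unfolding lin_ext_def lookup_sum
    by (rule sum.cong) (simp_all add: lookup_single when_def)
  then show "Poly_Mapping.lookup p k = Poly_Mapping.lookup (lin_ext (\<lambda>k. Poly_Mapping.single k 1) p) k"
    by (simp add: in_keys_iff)
qed

lemma qlinear_eq_lin_ext:
  assumes "qlinear F"
  shows "F p = lin_ext (\<lambda>k. F (Poly_Mapping.single k 1)) p"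
  by (subst poly_mapping_lin_ext[of p])
     (simp add: lin_ext_def qlinear_sum[OF assms] qlinear_scale[OF assms])


section \<open>Tensor product of rational vector spaces\<close>

definition tensor_relators :: "('a::rat_vector \<times> 'b::rat_vector \<Rightarrow>\<^sub>0 rat) set" where
  "tensor_relators =
     {Poly_Mapping.single (x + x', y) 1 - Poly_Mapping.single (x, y) 1 - Poly_Mapping.single (x', y) 1
        | x x' y. True} \<union>
     {Poly_Mapping.single (x, y + y') 1 - Poly_Mapping.single (x, y) 1 - Poly_Mapping.single (x, y') 1
        | x y y'. True} \<union>
     {Poly_Mapping.single (c *\<^sub>Q x, y) 1 - c *\<^sub>Q Poly_Mapping.single (x, y) 1 | c x y. True} \<union>
     {Poly_Mapping.single (x, c *\<^sub>Q y) 1 - c *\<^sub>Q Poly_Mapping.single (x, y) 1 | c x y. True}"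

definition tensor_rel ::
    "('a::rat_vector \<times> 'b::rat_vector \<Rightarrow>\<^sub>0 rat) \<Rightarrow> ('a \<times> 'b \<Rightarrow>\<^sub>0 rat) \<Rightarrow> bool"
  where "tensor_rel p q \<longleftrightarrow> p - q \<in> rat_vec.span tensor_relators"

lemma diff_diff_swap4: "(a - b) - (c - e) = (a - c) - (b - e)" for a b c e :: "'a::ab_group_add"
  by (simp add: algebra_simps)

lemma subspace_equivp:
  assumes "rat_vec.subspace S"
  shows "equivp (\<lambda>p q. p - q \<in> S)"
proof (rule equivpI)
  show "reflp (\<lambda>p q. p - q \<in> S)"
    using rat_vec.subspace_0[OF assms] by (simp add: reflp_def)
  show "symp (\<lambda>p q. p - q \<in> S)"
    using rat_vec.subspace_neg[OF assms] by (force simp: symp_def)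
  show "transp (\<lambda>p q. p - q \<in> S)"
    using rat_vec.subspace_add[OF assms] by (force simp: transp_def)
qed

quotient_type (overloaded) ('a, 'b) tensor =
    "'a::rat_vector \<times> 'b::rat_vector \<Rightarrow>\<^sub>0 rat" / tensor_rel
  unfolding tensor_rel_def by (rule subspace_equivp) simp

instantiation tensor :: (rat_vector, rat_vector) rat_vector
begin

lift_definition zero_tensor :: "('a, 'b) tensor" is 0 .

lift_definition plus_tensor :: "('a, 'b) tensor \<Rightarrow> ('a, 'b) tensor \<Rightarrow> ('a, 'b) tensor" is "(+)"
  unfolding tensor_rel_def by (subst add_diff_add) (rule rat_vec.span_add)

lift_definition uminus_tensor :: "('a, 'b) tensor \<Rightarrow> ('a, 'b) tensor" is uminus
  unfolding tensor_rel_def by (subst minus_diff_minus) (rule rat_vec.span_neg)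

lift_definition minus_tensor :: "('a, 'b) tensor \<Rightarrow> ('a, 'b) tensor \<Rightarrow> ('a, 'b) tensor" is "(-)"
  unfolding tensor_rel_def
  by (subst diff_diff_swap4) (rule rat_vec.span_diff)

lift_definition scaleQ_tensor :: "rat \<Rightarrow> ('a, 'b) tensor \<Rightarrow> ('a, 'b) tensor" is scaleQ
  unfolding tensor_rel_def by (subst rat_vec.scale_right_diff_distrib[symmetric]) (rule rat_vec.span_scale)

instance
proof
  fix a b c :: "('a, 'b) tensor" and r s :: rat
  note refl = equivp_reflp[OF tensor_equivp]
  show "a + b + c = a + (b + c)" by transfer (simp add: add.assoc refl)
  show "a + b = b + a" by transfer (simp add: add.commute refl)
  show "0 + a = a" by transfer (simp add: refl)
  show "- a + a = 0" by transfer (simp add: refl)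
  show "a - b = a + - b" by transfer (simp add: refl)
  show "r *\<^sub>Q (a + b) = r *\<^sub>Q a + r *\<^sub>Q b" by transfer (simp add: scaleQ_add_right refl)
  show "(r + s) *\<^sub>Q a = r *\<^sub>Q a + s *\<^sub>Q a" by transfer (simp add: scaleQ_add_left refl)
  show "r *\<^sub>Q s *\<^sub>Q a = (r * s) *\<^sub>Q a" by transfer (simp add: scaleQ_scaleQ refl)
  show "1 *\<^sub>Q a = a" by transfer (simp add: scaleQ_one refl)
qed

end

lift_definition tensor :: "'a::rat_vector \<Rightarrow> 'b::rat_vector \<Rightarrow> ('a, 'b) tensor"  (infixr \<open>\<otimes>\<close> 72)
  is "\<lambda>x y. Poly_Mapping.single (x, y) 1" .

text \<open>
  The linear map on the tensor product induced by a bilinear map. The definition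
  picks a representative; for bilinear \<open>f\<close> the choice is immaterial, as
  \<open>tlift_tensor\<close>, \<open>qlinear_tlift\<close> and \<open>tensor_induct\<close> below show.
\<close>

definition tlift ::
    "('a::rat_vector \<Rightarrow> 'b::rat_vector \<Rightarrow> 'c::rat_vector) \<Rightarrow> ('a, 'b) tensor \<Rightarrow> 'c"
  where "tlift f t = lin_ext (\<lambda>(x, y). f x y) (rep_tensor t)"

lemma tlift_abs:
  assumes "qbilinear f"
  shows "tlift f (abs_tensor p) = lin_ext (\<lambda>(x, y). f x y) p"
proof -
  let ?F = "lin_ext (\<lambda>(x, y). f x y)"
  have zero: "?F r = 0" if "r \<in> rat_vec.span tensor_relators" for r
    using that
  proof (induction rule: rat_vec.span_induct_alt)
    case base
    then show ?case by (simp add: qlinear_zero)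
  next
    case (step c x y)
    have "?F x = 0" using step(1)
      by (auto simp: tensor_relators_def qlinear_diff qlinear_scale scaleQ_one
          qlinear_add[OF qbilinearD(1)[OF assms]] qlinear_scale[OF qbilinearD(1)[OF assms]]
          qlinear_add[OF qbilinearD(2)[OF assms]] qlinear_scale[OF qbilinearD(2)[OF assms]])
    then show ?case using step by (simp add: qlinear_add qlinear_scale)
  qed
  have "tensor_rel (rep_tensor (abs_tensor p)) p"
    by (rule Quotient3_rep_abs[OF Quotient3_tensor equivp_reflp[OF tensor_equivp]])
  then have "?F (rep_tensor (abs_tensor p) - p) = 0"
    by (simp add: tensor_rel_def zero)
  then show ?thesis
    by (simp add: tlift_def qlinear_diff)
qed

lemma tlift_tensor: "qbilinear f \<Longrightarrow> tlift f (x \<otimes> y) = f x y"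
  unfolding tensor.abs_eq by (simp add: tlift_abs scaleQ_one)

lemma qlinear_tlift:
  assumes "qbilinear f"
  shows "qlinear (tlift f)"
proof (rule qlinearI)
  fix s t :: "('a, 'b) tensor" and c :: rat
  obtain p q where pq: "s = abs_tensor p" "t = abs_tensor q"
    using Quotient3_abs_rep[OF Quotient3_tensor] by metis
  show "tlift f (s + t) = tlift f s + tlift f t"
    by (simp add: pq plus_tensor.abs_eq tlift_abs[OF assms] qlinear_add)
  show "tlift f (c *\<^sub>Q s) = c *\<^sub>Q tlift f s"
    by (simp add: pq scaleQ_tensor.abs_eq tlift_abs[OF assms] qlinear_scale)
qed

lemma qbilinear_tensor: "qbilinear (\<otimes>)"
proof (rule qbilinearI)
  fix x x' :: 'a and y y' :: 'b and c :: rat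
  have R: "p - q \<in> tensor_relators \<Longrightarrow> abs_tensor p = abs_tensor q"
    for p q :: "'a \<times> 'b \<Rightarrow>\<^sub>0 rat"
    by (simp add: tensor.abs_eq_iff tensor_rel_def rat_vec.span_base)
  show "(x + x') \<otimes> y = x \<otimes> y + x' \<otimes> y"
    unfolding tensor.abs_eq plus_tensor.abs_eq
    by (rule R) (force simp: tensor_relators_def diff_diff_eq)
  show "x \<otimes> (y + y') = x \<otimes> y + x \<otimes> y'"
    unfolding tensor.abs_eq plus_tensor.abs_eq
    by (rule R) (force simp: tensor_relators_def diff_diff_eq)
  show "(c *\<^sub>Q x) \<otimes> y = c *\<^sub>Q (x \<otimes> y)"
    unfolding tensor.abs_eq scaleQ_tensor.abs_eq
    by (rule R) (force simp: tensor_relators_def)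
  show "x \<otimes> (c *\<^sub>Q y) = c *\<^sub>Q (x \<otimes> y)"
    unfolding tensor.abs_eq scaleQ_tensor.abs_eq
    by (rule R) (force simp: tensor_relators_def)
qed

lemma tensor_induct [case_names zero add]:
  assumes "P 0" "\<And>x y t. P t \<Longrightarrow> P (x \<otimes> y + t)"
  shows "P t"
proof -
  obtain p where p: "t = abs_tensor p"
    using Quotient3_abs_rep[OF Quotient3_tensor] by metis
  have abs_lin: "qlinear (abs_tensor :: ('a \<times> 'b \<Rightarrow>\<^sub>0 rat) \<Rightarrow> _)"
    by (rule qlinearI) (simp_all add: plus_tensor.abs_eq scaleQ_tensor.abs_eq)
  have e: "c *\<^sub>Q abs_tensor (Poly_Mapping.single k 1) = (c *\<^sub>Q fst k) \<otimes> snd k"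
    for c and k :: "'a \<times> 'b"
    by (cases k) (simp add: tensor.abs_eq[symmetric]
        qlinear_scale[OF qbilinearD(2)[OF qbilinear_tensor]])
  have "t = (\<Sum>k\<in>Poly_Mapping.keys p. (Poly_Mapping.lookup p k *\<^sub>Q fst k) \<otimes> snd k)"
    unfolding p by (subst qlinear_eq_lin_ext[OF abs_lin]) (simp only: lin_ext_def e)
  moreover have "P (\<Sum>k\<in>A. (Poly_Mapping.lookup p k *\<^sub>Q fst k) \<otimes> snd k)" if "finite A" for A
    using that by induction (simp_all add: assms)
  ultimately show ?thesis by simp
qed

definition tmap ::
    "('a::rat_vector \<Rightarrow> 'c::rat_vector) \<Rightarrow> ('b::rat_vector \<Rightarrow> 'd::rat_vector)
      \<Rightarrow> ('a, 'b) tensor \<Rightarrow> ('c, 'd) tensor"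
  where "tmap f g = tlift (\<lambda>x y. f x \<otimes> g y)"

definition tassoc ::
    "(('a::rat_vector, 'b::rat_vector) tensor, 'c::rat_vector) tensor
      \<Rightarrow> ('a, ('b, 'c) tensor) tensor"
  where "tassoc = tlift (\<lambda>t z. tlift (\<lambda>x y. x \<otimes> (y \<otimes> z)) t)"

text \<open>The product \<open>(a \<otimes> b) (a' \<otimes> b') = m a a' \<otimes> n b b'\<close> of a tensor product of algebras.\<close>

definition tmult ::
    "('a::rat_vector \<Rightarrow> 'a \<Rightarrow> 'a) \<Rightarrow> ('b::rat_vector \<Rightarrow> 'b \<Rightarrow> 'b)
      \<Rightarrow> ('a, 'b) tensor \<Rightarrow> ('a, 'b) tensor \<Rightarrow> ('a, 'b) tensor"
  where "tmult m n s t = tlift (\<lambda>a b. tlift (\<lambda>a' b'. m a a' \<otimes> n b b') t) s"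


lemma qbilinear_tensor_maps:
  assumes "qlinear f" "qlinear g"
  shows "qbilinear (\<lambda>x y. f x \<otimes> g y)"
  by (rule qbilinearI)
     (simp_all add: qlinear_add[OF assms(1)] qlinear_add[OF assms(2)]
        qlinear_scale[OF assms(1)] qlinear_scale[OF assms(2)]
        qlinear_add[OF qbilinearD(1)[OF qbilinear_tensor]]
        qlinear_scale[OF qbilinearD(1)[OF qbilinear_tensor]]
        qlinear_add[OF qbilinearD(2)[OF qbilinear_tensor]]
        qlinear_scale[OF qbilinearD(2)[OF qbilinear_tensor]])

lemma tmap_tensor:
  "qlinear f \<Longrightarrow> qlinear g \<Longrightarrow> tmap f g (x \<otimes> y) = f x \<otimes> g y"
  unfolding tmap_def by (simp add: tlift_tensor qbilinear_tensor_maps)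

lemma qlinear_tensor_eqI:
  assumes "qlinear f" "qlinear g" "\<And>x y. f (x \<otimes> y) = g (x \<otimes> y)"
  shows "f t = g t"
  by (induction t rule: tensor_induct)
     (simp_all add: assms(3) qlinear_zero[OF assms(1)] qlinear_zero[OF assms(2)]
        qlinear_add[OF assms(1)] qlinear_add[OF assms(2)])

lemma qlinear_comp: "qlinear f \<Longrightarrow> qlinear g \<Longrightarrow> qlinear (\<lambda>x. f (g x))"
  by (rule qlinearI) (simp_all add: qlinear_add qlinear_scale)

lemma qlinear_ident: "qlinear (\<lambda>x. x)"
  by (rule qlinearI) simp_all

lemma qlinear_id: "qlinear id"
  by (rule qlinearI) simp_all

lemma qlinear_plus: "qlinear f \<Longrightarrow> qlinear g \<Longrightarrow> qlinear (\<lambda>x. f x + g x)"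
  by (rule qlinearI) (simp_all add: qlinear_add qlinear_scale scaleQ_add_right)

lemma qlinear_smult: "qlinear f \<Longrightarrow> qlinear (\<lambda>x. c *\<^sub>Q f x)"
  by (rule qlinearI) (simp_all add: qlinear_add qlinear_scale scaleQ_add_right scaleQ_scaleQ mult.commute)

lemma qlinear_tlift_param:
  fixes g :: "'x::rat_vector \<Rightarrow> 'a::rat_vector \<Rightarrow> 'b::rat_vector \<Rightarrow> 'c::rat_vector"
  assumes "\<And>a b. qlinear (\<lambda>x. g x a b)" "\<And>x. qbilinear (g x)"
  shows "qlinear (\<lambda>x. tlift (g x) t)"
proof (rule qlinearI)
  fix x x' :: 'x and c :: rat
  note L = qlinear_tlift[OF assms(2)]
  show "tlift (g (x + x')) t = tlift (g x) t + tlift (g x') t"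
    by (rule qlinear_tensor_eqI[OF L qlinear_plus[OF L L]])
       (simp only: tlift_tensor[OF assms(2)], rule qlinear_add[OF assms(1)])
  show "tlift (g (c *\<^sub>Q x)) t = c *\<^sub>Q tlift (g x) t"
    by (rule qlinear_tensor_eqI[OF L qlinear_smult[OF L]])
       (simp only: tlift_tensor[OF assms(2)], rule qlinear_scale[OF assms(1)])
qed

lemma tassoc_inner:
  "qbilinear (\<lambda>x y. x \<otimes> (y \<otimes> z))"
  by (rule qbilinear_tensor_maps[OF qlinear_ident qbilinearD(2)[OF qbilinear_tensor]])

lemma tassoc_tensor: "tassoc ((x \<otimes> y) \<otimes> z) = x \<otimes> (y \<otimes> z)"
proof -
  have "qbilinear (\<lambda>t z. tlift (\<lambda>x y. x \<otimes> (y \<otimes> z)) t)"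
    unfolding qbilinear_def
    by (intro conjI allI qlinear_tlift tassoc_inner qlinear_tlift_param
        qlinear_comp[OF qbilinearD(1)[OF qbilinear_tensor] qbilinearD(1)[OF qbilinear_tensor]])
  then show ?thesis
    unfolding tassoc_def by (subst tlift_tensor) (simp_all add: tlift_tensor[OF tassoc_inner])
qed

lemma tmult_inner:
  assumes "qbilinear m" "qbilinear n"
  shows "qbilinear (\<lambda>a' b'. m a a' \<otimes> n b b')" "qbilinear (\<lambda>a b. tlift (\<lambda>a' b'. m a a' \<otimes> n b b') t)"
proof -
  show 1: "qbilinear (\<lambda>a' b'. m a a' \<otimes> n b b')" for a b
    by (intro qbilinear_tensor_maps qbilinearD assms)
  show "qbilinear (\<lambda>a b. tlift (\<lambda>a' b'. m a a' \<otimes> n b b') t)"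
    unfolding qbilinear_def
    by (intro conjI allI qlinear_tlift_param 1
         qlinear_comp[OF qbilinearD(1)[OF qbilinear_tensor] qbilinearD(2)[OF assms(2)]]
         qlinear_comp[OF qbilinearD(2)[OF qbilinear_tensor] qbilinearD(2)[OF assms(1)]])
qed

lemma tmult_tensor:
  assumes "qbilinear m" "qbilinear n"
  shows "tmult m n (a \<otimes> b) (a' \<otimes> b') = m a a' \<otimes> n b b'"
  unfolding tmult_def
  by (simp only: tlift_tensor[OF tmult_inner(2)[OF assms]])
     (simp only: tlift_tensor[OF tmult_inner(1)[OF assms]])

lemma qbilinear_tmult:
  assumes "qbilinear m" "qbilinear n"
  shows "qbilinear (tmult m n)"
  unfolding qbilinear_def tmult_def
  by (intro conjI allI qlinear_tlift tmult_inner assms qlinear_tlift_param)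

lemma tmult_assoc:
  assumes m: "qbilinear m" "\<And>x y z. m (m x y) z = m x (m y z)"
    and n: "qbilinear n" "\<And>x y z. n (n x y) z = n x (n y z)"
  shows "tmult m n (tmult m n s t) u = tmult m n s (tmult m n t u)"
proof -
  note L = qbilinearD[OF qbilinear_tmult[OF m(1) n(1)]]
  note tens = tmult_tensor[OF m(1) n(1)]
  have 1: "tmult m n (tmult m n (a \<otimes> b) (a' \<otimes> b')) u
      = tmult m n (a \<otimes> b) (tmult m n (a' \<otimes> b') u)" for a b a' b'
    by (rule qlinear_tensor_eqI[OF L(1) qlinear_comp[OF L(1) L(1)]]) (simp add: tens m n)
  have 2: "tmult m n (tmult m n (a \<otimes> b) t) u = tmult m n (a \<otimes> b) (tmult m n t u)" for a b
    by (rule qlinear_tensor_eqI[OF qlinear_comp[OF L(2) L(1)] qlinear_comp[OF L(1) L(2)]]) (rule 1)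
  show ?thesis
    by (rule qlinear_tensor_eqI[OF qlinear_comp[OF L(2) L(2)] L(2)]) (rule 2)
qed


section \<open>Hopf algebras over the rationals\<close>

locale unital_algebra =
  fixes mult :: "'h::rat_vector \<Rightarrow> 'h \<Rightarrow> 'h"
    and one :: 'h
  assumes mult_bilinear: "qbilinear mult"
    and mult_assoc: "mult (mult x y) z = mult x (mult y z)"
    and mult_one_left: "mult one x = x"
    and mult_one_right: "mult x one = x"

locale coalgebra =
  fixes comult :: "'h::rat_vector \<Rightarrow> ('h, 'h) tensor"
    and counit :: "'h \<Rightarrow> rat"
  assumes comult_linear: "qlinear comult"
    and counit_linear: "qlinear counit"
    and coassoc: "tassoc (tmap comult id (comult x)) = tmap id comult (comult x)"
    and counit_left: "tlift (\<lambda>a b. counit a *\<^sub>Q b) (comult x) = x"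
    and counit_right: "tlift (\<lambda>a b. counit b *\<^sub>Q a) (comult x) = x"

locale bialgebra = unital_algebra mult one + coalgebra comult counit
  for mult :: "'h::rat_vector \<Rightarrow> 'h \<Rightarrow> 'h" and one comult counit +
  assumes comult_mult: "comult (mult x y) = tmult mult mult (comult x) (comult y)"
    and comult_one: "comult one = one \<otimes> one"
    and counit_mult: "counit (mult x y) = counit x * counit y"
    and counit_one: "counit one = 1"

locale hopf_algebra = bialgebra mult one comult counit
  for mult :: "'h::rat_vector \<Rightarrow> 'h \<Rightarrow> 'h" and one comult counit +
  assumes antipode: "\<exists>S. qlinear S \<and>
      (\<forall>x. tlift (\<lambda>a b. mult (S a) b) (comult x) = counit x *\<^sub>Q one) \<and>
      (\<forall>x. tlift (\<lambda>a b. mult a (S b)) (comult x) = counit x *\<^sub>Q one)"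

locale commutative_hopf_algebra = hopf_algebra mult one comult counit
  for mult :: "'h::rat_vector \<Rightarrow> 'h \<Rightarrow> 'h" and one comult counit +
  assumes mult_commute: "mult x y = mult y x"


section \<open>The free algebra on the letters d and y\<close>

datatype letter = D | Y

text \<open>
  Words are lists of letters. Writing the free monoid additively (\<open>0\<close> is the empty word,
  \<open>+\<close> is concatenation) makes \<^term>\<open>(*)\<close> on \<^typ>\<open>'a list \<Rightarrow>\<^sub>0 rat\<close> the concatenation
  product of the free associative algebra.
\<close>

instantiation list :: (type) monoid_add
begin
definition zero_list :: "'a list" where "zero_list = []"
definition plus_list :: "'a list \<Rightarrow> 'a list \<Rightarrow> 'a list" where "plus_list = (@)"
instance by standard (simp_all add: zero_list_def plus_list_def)
end

type_synonym free_alg = "letter list \<Rightarrow>\<^sub>0 rat"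

definition word :: "letter list \<Rightarrow> free_alg"
  where "word w = Poly_Mapping.single w 1"

abbreviation d_letter :: free_alg  (\<open>d\<^sub>L\<close>) where "d\<^sub>L \<equiv> word [D]"
abbreviation y_letter :: free_alg  (\<open>y\<^sub>L\<close>) where "y\<^sub>L \<equiv> word [Y]"

lemma word_mult: "word u * word v = word (u @ v)"
  by (simp add: word_def mult_single plus_list_def)

lemma word_Nil: "word [] = 1"
  by (simp add: word_def zero_list_def[symmetric])

fun diamond_word :: "letter list \<Rightarrow> letter list \<Rightarrow> free_alg" where
  "diamond_word [] w = word w"
| "diamond_word w [] = word w"
| "diamond_word (Y # u) v = y\<^sub>L * diamond_word u v"
| "diamond_word u (Y # v) = y\<^sub>L * diamond_word u v"
| "diamond_word (D # u) (D # v) = d\<^sub>L * diamond_word u (D # v) - diamond_word u (D # D # v)"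

definition diamond :: "free_alg \<Rightarrow> free_alg \<Rightarrow> free_alg"  (infixl \<open>\<diamondop>\<close> 70)
  where "p \<diamondop> q = lin_ext (\<lambda>u. lin_ext (\<lambda>v. diamond_word u v) q) p"

lemma diamond_word_Y_left: "diamond_word (Y # u) v = y\<^sub>L * diamond_word u v"
  by (cases v) (cases u; simp add: word_mult)+

lemma diamond_word_Nil_right: "diamond_word u [] = word u"
  by (cases u) simp_all

lemma diamond_word_Y_right: "diamond_word u (Y # v) = y\<^sub>L * diamond_word u v"
proof (induction u)
  case (Cons a u)
  then show ?case
    by (cases a; cases v) (simp_all add: diamond_word_Y_left diamond_word_Nil_right word_mult)
qed (simp add: word_mult)

lemma diamond_word: "word u \<diamondop> word v = diamond_word u v"
  by (simp add: diamond_def word_def scaleQ_one)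

definition T_minus :: "free_alg set"
  where "T_minus = rat_vec.span {word (w @ [D]) | w. True}"

definition L_minus_gens :: "free_alg set" where
  "L_minus_gens =
    {d\<^sub>L ^ k * (d\<^sub>L * (word u \<diamondop> word v) - (d\<^sub>L * word u) \<diamondop> word v - word u \<diamondop> (d\<^sub>L * word v)) | k u v. True}"

definition diamond_ideal :: "free_alg set \<Rightarrow> bool" where
  "diamond_ideal I \<longleftrightarrow> rat_vec.subspace I \<and> (\<forall>a. \<forall>x\<in>I. a \<diamondop> x \<in> I \<and> x \<diamondop> a \<in> I)"

definition L_minus :: "free_alg set"
  where "L_minus = \<Inter> {I. diamond_ideal I \<and> L_minus_gens \<subseteq> I}"

fun coproduct_word :: "letter list \<Rightarrow> (free_alg, free_alg) tensor" where
  "coproduct_word [] = 1 \<otimes> 1"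
| "coproduct_word (x # w) =
     tmult (*) (*) (1 \<otimes> word [x] + word [x] \<otimes> 1) (coproduct_word w)"

definition coproduct0 :: "free_alg \<Rightarrow> (free_alg, free_alg) tensor"
  where "coproduct0 = lin_ext coproduct_word"

lemma scaleQ_eq_mult: "c *\<^sub>Q p = Poly_Mapping.single [] c * p" for p :: free_alg
  using mult_map_scale_conv_mult[of c p]
  by (simp add: scaleQ_poly_mapping_def zero_list_def scaleQ_rat_def[abs_def])

lemma mult_scaleQ: "p * c *\<^sub>Q q = c *\<^sub>Q (p * q)" for p q :: free_alg
proof -
  have comm: "p * Poly_Mapping.single [] c = Poly_Mapping.single [] c * p"
  proof -
    have "qlinear (\<lambda>p :: free_alg. p * Poly_Mapping.single [] c)"
      "qlinear (\<lambda>p :: free_alg. Poly_Mapping.single [] c * p)"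
      by (auto intro!: qlinearI simp: scaleQ_eq_mult distrib_left distrib_right mult.assoc[symmetric]
          mult_single plus_list_def mult.commute)
    then show ?thesis
      by (subst (1 2) qlinear_eq_lin_ext) (simp_all add: mult_single plus_list_def)
  qed
  show ?thesis by (simp add: scaleQ_eq_mult comm flip: mult.assoc)
qed

lemma qbilinear_times: "qbilinear ((*) :: free_alg \<Rightarrow> free_alg \<Rightarrow> free_alg)"
  by (rule qbilinearI) (simp_all add: distrib_left distrib_right mult_scaleQ, simp add: scaleQ_eq_mult mult.assoc)

lemma coproduct0_word: "coproduct0 (word w) = coproduct_word w"
  by (simp add: coproduct0_def word_def scaleQ_one)

lemma coproduct0_letter: "coproduct0 (word [x]) = 1 \<otimes> word [x] + word [x] \<otimes> 1"
proof -
  note B = qbilinear_times qbilinear_times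
  show ?thesis
    by (simp add: coproduct0_word qlinear_add[OF qbilinearD(2)[OF qbilinear_tmult[OF B]]]
        tmult_tensor[OF B])
qed

lemma coproduct0_one: "coproduct0 1 = 1 \<otimes> 1"
  by (simp add: coproduct0_word flip: word_Nil)

lemma coproduct0_mult: "coproduct0 (p * q) = tmult (*) (*) (coproduct0 p) (coproduct0 q)"
proof -
  note B = qbilinear_times qbilinear_times
  note T = qbilinear_tmult[OF B]
  have one: "tmult (*) (*) (1 \<otimes> 1) t = t" for t :: "(free_alg, free_alg) tensor"
    by (rule qlinear_tensor_eqI[OF qbilinearD(1)[OF T] qlinear_ident]) (simp add: tmult_tensor[OF B])
  have lin: "qlinear coproduct0" by (simp add: coproduct0_def[abs_def])
  have words: "coproduct_word (u @ v) = tmult (*) (*) (coproduct_word u) (coproduct_word v)" for u v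
    by (induction u) (simp_all add: one tmult_assoc[OF qbilinear_times _ qbilinear_times] mult.assoc)
  have ext: "F r = G r" if "qlinear F" "qlinear G" "\<And>w. F (word w) = G (word w)"
    for F G :: "free_alg \<Rightarrow> (free_alg, free_alg) tensor" and r
    using that(3)
    by (subst qlinear_eq_lin_ext[OF that(1)], subst qlinear_eq_lin_ext[OF that(2)]) (simp add: word_def)
  have "coproduct0 (word u * q) = tmult (*) (*) (coproduct0 (word u)) (coproduct0 q)" for u
    by (rule ext[OF qlinear_comp[OF lin qbilinearD(1)[OF qbilinear_times]]
          qlinear_comp[OF qbilinearD(1)[OF T] lin]])
       (simp add: word_mult coproduct0_word words)
  then show ?thesis
    by (rule ext[OF qlinear_comp[OF lin qbilinearD(2)[OF qbilinear_times]]
          qlinear_comp[OF qbilinearD(2)[OF T] lin]])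
qed

definition counit0 :: "free_alg \<Rightarrow> rat"
  where "counit0 p = Poly_Mapping.lookup p []"


section \<open>The quotient\<close>

definition H0_rel :: "free_alg \<Rightarrow> free_alg \<Rightarrow> bool"
  where "H0_rel p q \<longleftrightarrow> p - q \<in> {a + b | a b. a \<in> L_minus \<and> b \<in> T_minus}"

lemma subspace_L_minus: "rat_vec.subspace L_minus"
  unfolding L_minus_def diamond_ideal_def by (rule rat_vec.subspace_Inter) auto

lemma subspace_L_plus_T: "rat_vec.subspace {a + b | a b. a \<in> L_minus \<and> b \<in> T_minus}"
  by (rule rat_vec.subspace_sums) (simp_all add: subspace_L_minus T_minus_def)

quotient_type H0 = free_alg / H0_rel
  unfolding H0_rel_def by (rule subspace_equivp[OF subspace_L_plus_T])

instantiation H0 :: rat_vector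
begin

lift_definition zero_H0 :: H0 is 0 .

lift_definition plus_H0 :: "H0 \<Rightarrow> H0 \<Rightarrow> H0" is "(+)"
  unfolding H0_rel_def by (subst add_diff_add) (rule rat_vec.subspace_add[OF subspace_L_plus_T])

lift_definition uminus_H0 :: "H0 \<Rightarrow> H0" is uminus
  unfolding H0_rel_def by (subst minus_diff_minus) (rule rat_vec.subspace_neg[OF subspace_L_plus_T])

lift_definition minus_H0 :: "H0 \<Rightarrow> H0 \<Rightarrow> H0" is "(-)"
  unfolding H0_rel_def
  by (subst diff_diff_swap4) (rule rat_vec.subspace_diff[OF subspace_L_plus_T])

lift_definition scaleQ_H0 :: "rat \<Rightarrow> H0 \<Rightarrow> H0" is scaleQ
  unfolding H0_rel_def
  by (subst rat_vec.scale_right_diff_distrib[symmetric]) (rule rat_vec.subspace_scale[OF subspace_L_plus_T])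

instance
proof
  fix a b c :: H0 and r s :: rat
  note refl = equivp_reflp[OF H0_equivp]
  show "a + b + c = a + (b + c)" by transfer (simp add: add.assoc refl)
  show "a + b = b + a" by transfer (simp add: add.commute refl)
  show "0 + a = a" by transfer (simp add: refl)
  show "- a + a = 0" by transfer (simp add: refl)
  show "a - b = a + - b" by transfer (simp add: refl)
  show "r *\<^sub>Q (a + b) = r *\<^sub>Q a + r *\<^sub>Q b" by transfer (simp add: scaleQ_add_right refl)
  show "(r + s) *\<^sub>Q a = r *\<^sub>Q a + s *\<^sub>Q a" by transfer (simp add: scaleQ_add_left refl)
  show "r *\<^sub>Q s *\<^sub>Q a = (r * s) *\<^sub>Q a" by transfer (simp add: scaleQ_scaleQ refl)
  show "1 *\<^sub>Q a = a" by transfer (simp add: scaleQ_one refl)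
qed

end

end

theory Submission
  imports Defs
begin

text \<open>
  The point of the theorem is that \<open>\<H>\<^sub>0\<close> is a differential algebra in disguise. The generators of
  \<open>\<L>\<^sub>-\<close> say exactly that left concatenation with \<open>d\<close> obeys the Leibniz rule for \<open>\<diamondop>\<close>, and left
  concatenation with \<open>y\<close> is multiplication by \<open>y\<close>. So, modulo \<open>\<L>\<^sub>-\<close>, a word is an instruction for
  building an element from \<open>1\<close> by repeatedly differentiating and multiplying by \<open>y\<close>.

  First, \<open>\<T>\<^sub>- \<subseteq> \<L>\<^sub>-\<close> (\<open>T_minus_subset_L_minus\<close>): the generator for \<open>k = 0\<close>, \<open>u = v = 1\<close> is \<open>- d\<close>,
  and \<open>\<L>\<^sub>-\<close> is closed under prefixing either letter. For \<open>d\<close> this holds because the generators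
  come with all powers \<open>d\<^sup>k\<close>. Hence \<open>\<H>\<^sub>0\<close> is the quotient by \<open>\<L>\<^sub>-\<close> alone, and \<open>d\<close> acts
  on it as a derivation. Rewriting \<open>d a \<diamondop> b\<close> as \<open>d (a \<diamondop> b) - a \<diamondop> d b\<close> shortens the left
  factor, so commutativity and associativity follow by induction on that factor.

  Second, \<open>\<H>\<^sub>0\<close> maps to every commutative algebra \<open>A\<close> with a derivation and a chosen element
  \<open>a\<close>: letting \<open>d\<close> act as the derivation and \<open>y\<close> as multiplication by \<open>a\<close>, starting from the unit
  of \<open>A\<close>, evaluates words in \<open>A\<close>. The recursion for \<open>\<diamondop>\<close> is an instance of the
  Leibniz rule, so evaluation turns \<open>\<diamondop>\<close> into the product of \<open>A\<close> (\<open>eval_diamond\<close>) and vanishes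
  on \<open>\<L>\<^sub>-\<close> (\<open>eval_L_minus\<close>). All structure maps come from this one principle:
  \<^item> the coproduct is evaluation in \<open>\<H>\<^sub>0 \<otimes> \<H>\<^sub>0\<close> at \<open>1 \<otimes> y + y \<otimes> 1\<close> with derivation
    \<open>d \<otimes> 1 + 1 \<otimes> d\<close> (\<open>coproduct0_eval\<close>);
  \<^item> the counit is evaluation in \<open>\<rat>\<close> at \<open>0\<close> with the zero derivation (\<open>counit0_eval\<close>);
  \<^item> the antipode is evaluation in \<open>\<H>\<^sub>0\<close> at \<open>- y\<close>.

  This makes them well defined, and the coproduct and counit multiplicative. The remaining axioms
  are linear identities, valid at the unit and preserved by the two operators \<open>d\<close> and
  multiplication by \<open>y\<close>. Both operators \<open>L\<close> satisfy \<open>\<Delta> L = (L \<otimes> 1 + 1 \<otimes> L) \<Delta>\<close>, which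
  allows one argument to serve both letters.
\<close>

section \<open>Linear algebra of words and tensors\<close>

lemma free_alg_induct [case_names word add scale]:
  fixes p :: free_alg
  assumes "\<And>w. P (word w)" "\<And>p q. P p \<Longrightarrow> P q \<Longrightarrow> P (p + q)" "\<And>c p. P p \<Longrightarrow> P (c *\<^sub>Q p)"
  shows "P p"
proof -
  have zero: "P 0"
    using assms(3)[OF assms(1), of 0] by simp
  have "P (\<Sum>k\<in>A. Poly_Mapping.lookup p k *\<^sub>Q word k)" if "finite A" for A
    using that by induction (simp_all add: assms zero)
  then show ?thesis
    by (subst poly_mapping_lin_ext) (simp add: lin_ext_def word_def)
qed

lemma qlinear_word_eqI:
  assumes "qlinear f" "qlinear g" "\<And>w. f (word w) = g (word w)"
  shows "f p = g p"
  by (induction p rule: free_alg_induct)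
     (simp_all add: assms(3) qlinear_add[OF assms(1)] qlinear_add[OF assms(2)]
       qlinear_scale[OF assms(1)] qlinear_scale[OF assms(2)])

lemma qbilinear_word_eqI:
  assumes "qbilinear f" "qbilinear g" "\<And>u v. f (word u) (word v) = g (word u) (word v)"
  shows "f p q = g p q"
proof -
  have "f (word u) q = g (word u) q" for u
    by (rule qlinear_word_eqI[OF assms(1,2)[THEN qbilinearD(1)] assms(3)])
  then show ?thesis
    by (rule qlinear_word_eqI[OF assms(1,2)[THEN qbilinearD(2)]])
qed

lemma word_induct [case_names Nil D Y]:
  assumes "P []" "\<And>w. P w \<Longrightarrow> P (D # w)" "\<And>w. P w \<Longrightarrow> P (Y # w)"
  shows "P w"
proof (induction w)
  case (Cons a w)
  then show ?case using assms by (cases a) simp_all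
qed (rule assms)

lemma
  assumes "qbilinear f"
  shows qbilinear_add_left: "f (x + x') y = f x y + f x' y"
    and qbilinear_add_right: "f x (y + y') = f x y + f x y'"
    and qbilinear_scale_left: "f (c *\<^sub>Q x) y = c *\<^sub>Q f x y"
    and qbilinear_scale_right: "f x (c *\<^sub>Q y) = c *\<^sub>Q f x y"
    and qbilinear_zero_left: "f 0 y = 0"
    and qbilinear_zero_right: "f x 0 = 0"
    and qbilinear_diff_left: "f (x - x') y = f x y - f x' y"
    and qbilinear_diff_right: "f x (y - y') = f x y - f x y'"
  using qlinear_add[OF qbilinearD(2)[OF assms]] qlinear_add[OF qbilinearD(1)[OF assms]]
    qlinear_scale[OF qbilinearD(2)[OF assms]] qlinear_scale[OF qbilinearD(1)[OF assms]]
    qlinear_zero[OF qbilinearD(2)[OF assms]] qlinear_zero[OF qbilinearD(1)[OF assms]]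
    qlinear_diff[OF qbilinearD(2)[OF assms]] qlinear_diff[OF qbilinearD(1)[OF assms]]
  by blast+

lemmas qbilinear_simps = qbilinear_add_left qbilinear_add_right qbilinear_scale_left
  qbilinear_scale_right qbilinear_zero_left qbilinear_zero_right
  qbilinear_diff_left qbilinear_diff_right

lemmas qlinear_simps = qlinear_add qlinear_scale qlinear_zero qlinear_diff

lemma qbilinear_comp:
  assumes "qbilinear f" "qlinear g" "qlinear h" "qlinear k"
  shows "qbilinear (\<lambda>x y. k (f (g x) (h y)))"
  by (rule qbilinearI)
     (simp_all add: qbilinear_simps[OF assms(1)] qlinear_simps[OF assms(2)]
       qlinear_simps[OF assms(3)] qlinear_simps[OF assms(4)])

lemmas [simp] = qbilinear_simps[OF qbilinear_tensor]

lemma qlinear_tmap: "qlinear f \<Longrightarrow> qlinear g \<Longrightarrow> qlinear (tmap f g)"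
  unfolding tmap_def by (intro qlinear_tlift qbilinear_tensor_maps)

lemma qlinear_tassoc: "qlinear tassoc"
proof -
  have "qbilinear (\<lambda>t z. tlift (\<lambda>x y. x \<otimes> (y \<otimes> z)) t)"
    unfolding qbilinear_def
    by (intro conjI allI qlinear_tlift tassoc_inner qlinear_tlift_param
        qlinear_comp[OF qbilinearD(1)[OF qbilinear_tensor] qbilinearD(1)[OF qbilinear_tensor]])
  then show ?thesis
    unfolding tassoc_def by (rule qlinear_tlift)
qed

text \<open>
  The operator \<open>L \<otimes> 1 + 1 \<otimes> L\<close>. For a derivation \<open>L\<close> it is the derivation of the tensor square;
  for multiplication by \<open>a\<close> it is multiplication by \<open>1 \<otimes> a + a \<otimes> 1\<close>.
\<close>

definition tleibniz :: "('a::rat_vector \<Rightarrow> 'a) \<Rightarrow> ('a, 'a) tensor \<Rightarrow> ('a, 'a) tensor"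
  where "tleibniz L t = tmap L id t + tmap id L t"

lemma qlinear_tleibniz: "qlinear L \<Longrightarrow> qlinear (tleibniz L)"
  unfolding tleibniz_def[abs_def] by (intro qlinear_plus qlinear_tmap qlinear_id)

lemma tleibniz_tensor: "qlinear L \<Longrightarrow> tleibniz L (a \<otimes> b) = L a \<otimes> b + a \<otimes> L b"
  by (simp add: tleibniz_def tmap_tensor qlinear_id)

lemma tmap_tleibniz:
  assumes "qlinear f" "qlinear L" "qlinear M" "\<And>x. f (L x) = M (f x)"
  shows "tmap f f (tleibniz L t) = tleibniz M (tmap f f t)"
  by (induction t rule: tensor_induct)
     (simp_all add: assms tleibniz_tensor tmap_tensor qlinear_simps[OF qlinear_tmap]
       qlinear_simps[OF qlinear_tleibniz])

text \<open>
  If \<open>\<Delta> L = (L \<otimes> 1 + 1 \<otimes> L) \<Delta>\<close>, then \<open>L\<close> can be pulled out of both iterated coproducts and becomes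
  \<open>L \<otimes> 1 \<otimes> 1 + 1 \<otimes> L \<otimes> 1 + 1 \<otimes> 1 \<otimes> L\<close> in either case. Coassociativity therefore passes from \<open>x\<close> to
  \<open>L x\<close>.
\<close>

lemma coassoc_tleibniz:
  assumes comult: "qlinear comult" and L: "qlinear L"
    and comult_L: "\<And>x. comult (L x) = tleibniz L (comult x)"
    and coassoc: "tassoc (tmap comult id (comult x)) = tmap id comult (comult x)"
  shows "tassoc (tmap comult id (comult (L x))) = tmap id comult (comult (L x))"
proof -
  (* L acting on each of the three tensor factors in turn. *)
  let ?M = "\<lambda>t. tmap L id t + tmap id (tleibniz L) t"
  note lin = qlinear_tassoc qlinear_tmap qlinear_id qlinear_ident comult L qlinear_tleibniz
  note lin_simps = lin qlinear_simps[OF qlinear_tassoc] qlinear_simps[OF qlinear_tmap]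
    qlinear_simps[OF qlinear_tleibniz] qlinear_simps[OF L] qlinear_simps[OF comult]
    tmap_tensor tassoc_tensor tleibniz_tensor comult_L
  have T: "tassoc (t \<otimes> L b) + tassoc (tleibniz L t \<otimes> b) = ?M (tassoc (t \<otimes> b))" for t b
    by (induction t rule: tensor_induct)
      (simp_all add: lin_simps algebra_simps)
  have A: "tassoc (tmap comult id (tleibniz L t)) = ?M (tassoc (tmap comult id t))" for t
    by (induction t rule: tensor_induct) (simp_all add: lin_simps T[unfolded id_def] algebra_simps)
  have B: "tmap id comult (tleibniz L t) = ?M (tmap id comult t)" for t
    by (induction t rule: tensor_induct) (simp_all add: lin_simps algebra_simps)
  show ?thesis
    by (simp only: comult_L A B coassoc)
qed

lemma qbilinear_scale_functional:
  assumes "qlinear f"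
  shows "qbilinear (\<lambda>a b. f a *\<^sub>Q b)" "qbilinear (\<lambda>a b. f b *\<^sub>Q a)"
  by (auto intro!: qbilinearI simp: qlinear_simps[OF assms] scaleQ_add_left scaleQ_add_right
      scaleQ_scaleQ mult.commute)

text \<open>
  The analogue for the counit axioms: since \<open>\<epsilon> L = 0\<close>, the summand of \<open>L \<otimes> 1 + 1 \<otimes> L\<close> in
  which \<open>L\<close> acts on the contracted factor disappears.
\<close>

lemma counit_tleibniz:
  assumes "qlinear counit" "qlinear L" "\<And>x. counit (L x) = 0"
  shows "tlift (\<lambda>a b. counit a *\<^sub>Q b) (tleibniz L t) = L (tlift (\<lambda>a b. counit a *\<^sub>Q b) t)"
    and "tlift (\<lambda>a b. counit b *\<^sub>Q a) (tleibniz L t) = L (tlift (\<lambda>a b. counit b *\<^sub>Q a) t)"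
proof -
  note B = qbilinear_scale_functional[OF assms(1)]
  note S = qlinear_simps[OF qlinear_tlift[OF B(1)]] qlinear_simps[OF qlinear_tlift[OF B(2)]]
    tlift_tensor[OF B(1)] tlift_tensor[OF B(2)] qlinear_simps[OF assms(2)]
    qlinear_simps[OF qlinear_tleibniz[OF assms(2)]] tleibniz_tensor[OF assms(2)] assms(3)
  show "tlift (\<lambda>a b. counit a *\<^sub>Q b) (tleibniz L t) = L (tlift (\<lambda>a b. counit a *\<^sub>Q b) t)"
    by (induction t rule: tensor_induct) (simp_all add: S)
  show "tlift (\<lambda>a b. counit b *\<^sub>Q a) (tleibniz L t) = L (tlift (\<lambda>a b. counit b *\<^sub>Q a) t)"
    by (induction t rule: tensor_induct) (simp_all add: S)
qed


section \<open>The product and the ideal\<close>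

lemma qbilinear_diamond: "qbilinear (\<diamondop>)"
proof -
  have "p \<diamondop> q = lin_ext (\<lambda>v. lin_ext (\<lambda>u. diamond_word u v) p) q" for p q
    unfolding diamond_def lin_ext_def rat_vec.scale_sum_right scaleQ_scaleQ
    by (subst sum.swap) (simp add: mult.commute)
  then have "(\<diamondop>) p = lin_ext (\<lambda>v. lin_ext (\<lambda>u. diamond_word u v) p)" for p
    by blast
  then have "qlinear ((\<diamondop>) p)" for p
    by simp
  moreover have "qlinear (\<lambda>p. p \<diamondop> q)" for q
    by (simp add: diamond_def)
  ultimately show ?thesis
    by (simp add: qbilinear_def)
qed

lemmas diamond_simps = qbilinear_simps[OF qbilinear_diamond]
lemmas times_simps = qbilinear_simps[OF qbilinear_times]

lemma diamond_one_left: "1 \<diamondop> p = p"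
  by (rule qlinear_word_eqI[OF qbilinearD(1)[OF qbilinear_diamond] qlinear_ident])
     (simp add: diamond_word flip: word_Nil)

lemma diamond_one_right: "p \<diamondop> 1 = p"
  by (rule qlinear_word_eqI[OF qbilinearD(2)[OF qbilinear_diamond] qlinear_ident])
     (simp add: diamond_word diamond_word_Nil_right flip: word_Nil)

lemma diamond_Y_left: "(y\<^sub>L * p) \<diamondop> q = y\<^sub>L * (p \<diamondop> q)"
proof (rule qbilinear_word_eqI[where p = p and q = q])
  note B = qbilinear_diamond and T = qbilinearD(1)[OF qbilinear_times]
  show "qbilinear (\<lambda>p q. (y\<^sub>L * p) \<diamondop> q)" "qbilinear (\<lambda>p q. y\<^sub>L * (p \<diamondop> q))"
    using qbilinear_comp[OF B T qlinear_ident qlinear_ident]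
      qbilinear_comp[OF B qlinear_ident qlinear_ident T] by simp_all
qed (simp add: word_mult diamond_word diamond_word_Y_left)

lemma diamond_Y_right: "p \<diamondop> (y\<^sub>L * q) = y\<^sub>L * (p \<diamondop> q)"
proof (rule qbilinear_word_eqI[where p = p and q = q])
  note B = qbilinear_diamond and T = qbilinearD(1)[OF qbilinear_times]
  show "qbilinear (\<lambda>p q. p \<diamondop> (y\<^sub>L * q))" "qbilinear (\<lambda>p q. y\<^sub>L * (p \<diamondop> q))"
    using qbilinear_comp[OF B qlinear_ident T qlinear_ident]
      qbilinear_comp[OF B qlinear_ident qlinear_ident T] by simp_all
qed (simp add: word_mult diamond_word diamond_word_Y_right)

lemma diamond_ideal_L_minus: "diamond_ideal L_minus"
  unfolding diamond_ideal_def using subspace_L_minus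
  by (auto simp: L_minus_def diamond_ideal_def)

lemma L_minus_gens_subset: "L_minus_gens \<subseteq> L_minus"
  by (auto simp: L_minus_def)

lemma L_minus_least: "diamond_ideal I \<Longrightarrow> L_minus_gens \<subseteq> I \<Longrightarrow> L_minus \<subseteq> I"
  by (auto simp: L_minus_def)

lemmas L_minus_0 = rat_vec.subspace_0[OF subspace_L_minus]
lemmas L_minus_add = rat_vec.subspace_add[OF subspace_L_minus]
lemmas L_minus_scale = rat_vec.subspace_scale[OF subspace_L_minus]

lemma L_minus_diamond: "x \<in> L_minus \<Longrightarrow> a \<diamondop> x \<in> L_minus" "x \<in> L_minus \<Longrightarrow> x \<diamondop> a \<in> L_minus"
  using diamond_ideal_L_minus by (auto simp: diamond_ideal_def)

text \<open>
  For words this is a generator with \<open>k = 0\<close>; the Leibniz defect is bilinear.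
\<close>

lemma leibniz_mod_L_minus:
  "d\<^sub>L * (p \<diamondop> q) - (d\<^sub>L * p) \<diamondop> q - p \<diamondop> (d\<^sub>L * q) \<in> L_minus" (is "?E p q \<in> _")
proof -
  have add: "?E (p + p') q = ?E p q + ?E p' q" "?E q (p + p') = ?E q p + ?E q p'"
    and scale: "?E (c *\<^sub>Q p) q = c *\<^sub>Q ?E p q" "?E q (c *\<^sub>Q p) = c *\<^sub>Q ?E q p" for p p' q c
    by (simp_all add: diamond_simps times_simps rat_vec.scale_right_diff_distrib)
  have "?E (word u) (word v) \<in> L_minus" for u v
  proof -
    have "d\<^sub>L ^ 0 * ?E (word u) (word v) \<in> L_minus_gens"
      unfolding L_minus_gens_def by blast
    then show ?thesis
      using L_minus_gens_subset by auto
  qed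
  then have "?E (word u) q \<in> L_minus" for u
    by (induction q rule: free_alg_induct) (simp_all add: add scale L_minus_add L_minus_scale)
  then show ?thesis
    by (induction p rule: free_alg_induct) (simp_all add: add scale L_minus_add L_minus_scale)
qed

text \<open>
  Prefixing \<open>y\<close> is \<open>\<diamondop>\<close>-multiplication by \<open>y\<close>, under which an ideal is closed.
\<close>

lemma L_minus_times_Y: "x \<in> L_minus \<Longrightarrow> y\<^sub>L * x \<in> L_minus"
  using L_minus_diamond(1)[of x y\<^sub>L] diamond_Y_left[of 1 x] by (simp add: diamond_one_left)

text \<open>
  The elements \<open>x\<close> of \<open>\<L>\<^sub>-\<close> with \<open>d x \<in> \<L>\<^sub>-\<close> form an ideal, by the Leibniz rule modulo \<open>\<L>\<^sub>-\<close>, and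
  this ideal contains the generators, because prefixing a generator by \<open>d\<close> only raises its
  exponent \<open>k\<close>. Minimality of \<open>\<L>\<^sub>-\<close> does the rest.
\<close>

lemma L_minus_times_D:
  assumes "x \<in> L_minus"
  shows "d\<^sub>L * x \<in> L_minus"
proof -
  let ?J = "{x \<in> L_minus. d\<^sub>L * x \<in> L_minus}"
  have "diamond_ideal ?J"
    unfolding diamond_ideal_def
  proof (intro conjI allI ballI)
    show "rat_vec.subspace ?J"
      by (auto intro!: rat_vec.subspaceI simp: L_minus_0 L_minus_add L_minus_scale times_simps)
    fix a x assume "x \<in> ?J"
    then have x: "x \<in> L_minus" "d\<^sub>L * x \<in> L_minus" by auto
    have E: "d\<^sub>L * (p \<diamondop> q) \<in> L_minus" if "(d\<^sub>L * p) \<diamondop> q \<in> L_minus" "p \<diamondop> (d\<^sub>L * q) \<in> L_minus" for p q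
      using L_minus_add[OF L_minus_add[OF leibniz_mod_L_minus[of p q] that(2)] that(1)] by simp
    show "a \<diamondop> x \<in> ?J" "x \<diamondop> a \<in> ?J"
      using x by (auto intro!: E intro: L_minus_diamond)
  qed
  moreover have "L_minus_gens \<subseteq> ?J"
  proof
    fix g assume g: "g \<in> L_minus_gens"
    then have "d\<^sub>L * g \<in> L_minus_gens"
      unfolding L_minus_gens_def by (clarsimp simp flip: mult.assoc power_Suc) blast
    with g show "g \<in> ?J" using L_minus_gens_subset by auto
  qed
  ultimately show ?thesis
    using L_minus_least assms by blast
qed

text \<open>
  At \<open>p = q = 1\<close> the Leibniz defect is \<open>d - d - d = - d\<close>, so \<open>d\<close> itself lies in \<open>\<L>\<^sub>-\<close>.
\<close>

lemma T_minus_subset_L_minus: "T_minus \<subseteq> L_minus"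
proof -
  have d: "d\<^sub>L \<in> L_minus"
    using rat_vec.subspace_neg[OF subspace_L_minus leibniz_mod_L_minus[of 1 1]]
    by (simp add: diamond_one_left diamond_one_right)
  have "word (w @ [D]) \<in> L_minus" for w
    using d L_minus_times_D L_minus_times_Y
    by (induction w rule: word_induct) (force simp: word_mult)+
  then show ?thesis
    unfolding T_minus_def by (intro rat_vec.span_minimal subspace_L_minus) auto
qed

lemma L_plus_T_eq: "{a + b | a b. a \<in> L_minus \<and> b \<in> T_minus} = L_minus"
proof
  show "{a + b | a b. a \<in> L_minus \<and> b \<in> T_minus} \<subseteq> L_minus"
    using T_minus_subset_L_minus L_minus_add by auto
  have "x + 0 \<in> {a + b | a b. a \<in> L_minus \<and> b \<in> T_minus}" if "x \<in> L_minus" for x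
    using that rat_vec.span_zero unfolding T_minus_def by blast
  then show "L_minus \<subseteq> {a + b | a b. a \<in> L_minus \<and> b \<in> T_minus}"
    by auto
qed

lemma H0_rel_iff: "H0_rel p q \<longleftrightarrow> p - q \<in> L_minus"
  by (simp add: H0_rel_def L_plus_T_eq)


section \<open>The quotient as a commutative differential algebra\<close>

lemma qlinear_abs_H0: "qlinear abs_H0"
  by (rule qlinearI) (simp_all add: plus_H0.abs_eq scaleQ_H0.abs_eq)

lemma H0_cases: obtains p where "x = abs_H0 p"
  using Quotient3_abs_rep[OF Quotient3_H0] by metis

lemma abs_H0_eqI: "p - q \<in> L_minus \<Longrightarrow> abs_H0 p = abs_H0 q"
  by (simp add: H0.abs_eq_iff H0_rel_iff)

lift_definition mult_H0 :: "H0 \<Rightarrow> H0 \<Rightarrow> H0" is "(\<diamondop>)"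
proof -
  fix p p' q q' assume "H0_rel p p'" "H0_rel q q'"
  then have "(p - p') \<diamondop> q + p' \<diamondop> (q - q') \<in> L_minus"
    by (intro L_minus_add L_minus_diamond) (simp_all add: H0_rel_iff)
  then show "H0_rel (p \<diamondop> q) (p' \<diamondop> q')"
    by (simp add: H0_rel_iff diamond_simps)
qed

lift_definition der_H0 :: "H0 \<Rightarrow> H0" is "(*) d\<^sub>L"
  unfolding H0_rel_iff right_diff_distrib[symmetric] by (rule L_minus_times_D)

abbreviation one_H0 :: H0 where "one_H0 \<equiv> abs_H0 1"
abbreviation y_H0 :: H0 where "y_H0 \<equiv> abs_H0 y\<^sub>L"

lemma qbilinear_mult_H0: "qbilinear mult_H0"
proof (rule qbilinearI)
  fix x x' y y' :: H0 and c :: rat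
  obtain p p' q q' where "x = abs_H0 p" "x' = abs_H0 p'" "y = abs_H0 q" "y' = abs_H0 q'"
    by (metis H0_cases)
  then show "mult_H0 (x + x') y = mult_H0 x y + mult_H0 x' y"
    "mult_H0 (c *\<^sub>Q x) y = c *\<^sub>Q mult_H0 x y"
    "mult_H0 x (y + y') = mult_H0 x y + mult_H0 x y'"
    "mult_H0 x (c *\<^sub>Q y) = c *\<^sub>Q mult_H0 x y"
    by (simp_all add: mult_H0.abs_eq plus_H0.abs_eq scaleQ_H0.abs_eq diamond_simps)
qed

lemma qlinear_der_H0: "qlinear der_H0"
proof (rule qlinearI)
  fix x y :: H0 and c :: rat
  obtain p q where "x = abs_H0 p" "y = abs_H0 q"
    by (metis H0_cases)
  then show "der_H0 (x + y) = der_H0 x + der_H0 y" "der_H0 (c *\<^sub>Q x) = c *\<^sub>Q der_H0 x"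
    by (simp_all add: der_H0.abs_eq plus_H0.abs_eq scaleQ_H0.abs_eq times_simps)
qed

lemma der_H0_mult: "der_H0 (mult_H0 x y) = mult_H0 (der_H0 x) y + mult_H0 x (der_H0 y)"
proof -
  obtain p q where "x = abs_H0 p" "y = abs_H0 q"
    by (metis H0_cases)
  moreover have "abs_H0 (d\<^sub>L * (p \<diamondop> q)) = abs_H0 ((d\<^sub>L * p) \<diamondop> q + p \<diamondop> (d\<^sub>L * q))"
    using leibniz_mod_L_minus[of p q] by (intro abs_H0_eqI) (simp add: diff_diff_eq)
  ultimately show ?thesis
    by (simp add: der_H0.abs_eq mult_H0.abs_eq plus_H0.abs_eq)
qed

lemma mult_y_H0: "mult_H0 y_H0 (abs_H0 p) = abs_H0 (y\<^sub>L * p)"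
  using diamond_Y_left[of 1 p] by (simp add: mult_H0.abs_eq diamond_one_left)

lemma mult_H0_one_left: "mult_H0 one_H0 x = x" and mult_H0_one_right: "mult_H0 x one_H0 = x"
  by (cases x rule: H0_cases; simp add: mult_H0.abs_eq diamond_one_left diamond_one_right)+

lemma mult_H0_y_left: "mult_H0 (mult_H0 y_H0 a) b = mult_H0 y_H0 (mult_H0 a b)"
  and mult_H0_y_right: "mult_H0 a (mult_H0 y_H0 b) = mult_H0 y_H0 (mult_H0 a b)"
proof -
  obtain p q where "a = abs_H0 p" "b = abs_H0 q"
    by (metis H0_cases)
  show "mult_H0 (mult_H0 y_H0 a) b = mult_H0 y_H0 (mult_H0 a b)"
    by (simp only: mult_y_H0 mult_H0.abs_eq[of p] mult_H0.abs_eq[of "y\<^sub>L * p"] diamond_Y_left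
        \<open>a = _\<close> \<open>b = _\<close>)
  show "mult_H0 a (mult_H0 y_H0 b) = mult_H0 y_H0 (mult_H0 a b)"
    by (simp only: mult_y_H0 mult_H0.abs_eq[of p] diamond_Y_right \<open>a = _\<close> \<open>b = _\<close>)
qed

text \<open>
  Every element arises from the unit by differentiation, multiplication by \<open>y\<close> and linear
  combination, since a word is the result of applying its letters to the unit.
\<close>

lemma H0_induct [case_names one der y add scale]:
  assumes "P one_H0" "\<And>a. P a \<Longrightarrow> P (der_H0 a)" "\<And>a. P a \<Longrightarrow> P (mult_H0 y_H0 a)"
    and "\<And>a b. P a \<Longrightarrow> P b \<Longrightarrow> P (a + b)" "\<And>c a. P a \<Longrightarrow> P (c *\<^sub>Q a)"
  shows "P x"
proof -
  have "P (abs_H0 (word w))" for w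
  proof (induction w rule: word_induct)
    case (D w)
    then show ?case using assms(2)[OF D] by (simp add: der_H0.abs_eq word_mult)
  next
    case (Y w)
    then show ?case using assms(3)[OF Y] by (simp add: mult_y_H0 word_mult)
  qed (simp add: word_Nil assms)
  then have "P (abs_H0 p)" for p
    by (induction p rule: free_alg_induct)
       (simp_all add: qlinear_simps[OF qlinear_abs_H0] assms)
  then show ?thesis
    by (metis H0_cases)
qed

lemmas mult_H0_simps = qbilinear_simps[OF qbilinear_mult_H0]

text \<open>
  Read from left to right, the Leibniz rule moves the derivation off the left factor. This is the
  reduction that drives the inductions for commutativity and associativity.
\<close>

lemma mult_der_H0: "mult_H0 (der_H0 x) y = der_H0 (mult_H0 x y) - mult_H0 x (der_H0 y)"
  by (simp add: der_H0_mult)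

lemma mult_H0_commute: "mult_H0 x y = mult_H0 y x"
proof (induction x arbitrary: y rule: H0_induct)
  case (der a)
  then show ?case
    by (simp add: mult_der_H0)
qed (simp_all add: mult_H0_one_left mult_H0_one_right mult_H0_y_left mult_H0_y_right mult_H0_simps)

lemma mult_H0_assoc: "mult_H0 (mult_H0 x y) z = mult_H0 x (mult_H0 y z)"
proof (induction x arbitrary: y z rule: H0_induct)
  case (der a)
  then show ?case
    by (simp add: mult_der_H0 mult_H0_simps)
qed (simp_all add: mult_H0_one_left mult_H0_one_right mult_H0_y_left mult_H0_simps)


section \<open>Evaluation of words in commutative differential algebras\<close>

locale commutative_differential_algebra = unital_algebra mult one
  for mult :: "'h::rat_vector \<Rightarrow> 'h \<Rightarrow> 'h" and one +
  fixes der :: "'h \<Rightarrow> 'h"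
  assumes mult_commute: "mult x y = mult y x"
    and der_linear: "qlinear der"
    and der_mult: "der (mult x y) = mult (der x) y + mult x (der y)"
begin

lemmas mult_simps = qbilinear_simps[OF mult_bilinear]

lemma mult_left_commute: "mult x (mult y z) = mult y (mult x z)"
  by (simp only: mult_assoc[symmetric] mult_commute[of x y])

lemma der_one: "der one = 0"
  using der_mult[of one one] by (simp add: mult_one_left mult_one_right)

fun eval_word :: "'h \<Rightarrow> letter list \<Rightarrow> 'h" where
  "eval_word a [] = one"
| "eval_word a (D # w) = der (eval_word a w)"
| "eval_word a (Y # w) = mult a (eval_word a w)"

definition eval :: "'h \<Rightarrow> free_alg \<Rightarrow> 'h"
  where "eval a = lin_ext (eval_word a)"

lemma qlinear_eval: "qlinear (eval a)"
  by (simp add: eval_def)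

lemmas eval_simps = qlinear_simps[OF qlinear_eval]

lemma eval_word: "eval a (word w) = eval_word a w"
  by (simp add: eval_def word_def scaleQ_one)

lemma eval_one: "eval a 1 = one"
  by (simp add: eval_word flip: word_Nil)

lemma eval_times_D: "eval a (d\<^sub>L * p) = der (eval a p)"
  and eval_times_Y: "eval a (y\<^sub>L * p) = mult a (eval a p)"
  by (induction p rule: free_alg_induct;
      simp add: word_mult eval_word times_simps eval_simps mult_simps qlinear_simps[OF der_linear])+

lemma eval_unique:
  assumes "qlinear f" "f 1 = one" "\<And>p. f (d\<^sub>L * p) = der (f p)" "\<And>p. f (y\<^sub>L * p) = mult a (f p)"
  shows "f p = eval a p"
proof (rule qlinear_word_eqI[OF assms(1) qlinear_eval])
  show "f (word w) = eval a (word w)" for w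
  proof (induction w rule: word_induct)
    case (D w)
    then show ?case using assms(3)[of "word w"] by (simp add: word_mult eval_word)
  next
    case (Y w)
    then show ?case using assms(4)[of "word w"] by (simp add: word_mult eval_word)
  qed (simp add: eval_one assms word_Nil)
qed

text \<open>
  The clause \<open>d u \<diamondop> d v = d (u \<diamondop> d v) - u \<diamondop> d d v\<close> is the Leibniz rule for the factors \<open>u\<close> and
  \<open>d v\<close>, solved for \<open>d u \<diamondop> d v\<close>, so it holds for the product of any differential algebra; the
  clauses for \<open>y\<close> hold in any commutative algebra.
\<close>

lemma eval_diamond: "eval a (p \<diamondop> q) = mult (eval a p) (eval a q)"
proof (rule qbilinear_word_eqI[where p = p and q = q])
  show "qbilinear (\<lambda>p q. eval a (p \<diamondop> q))" "qbilinear (\<lambda>p q. mult (eval a p) (eval a q))"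
    using qbilinear_comp[OF qbilinear_diamond qlinear_ident qlinear_ident qlinear_eval]
      qbilinear_comp[OF mult_bilinear qlinear_eval qlinear_eval qlinear_ident] by simp_all
  show "eval a (word u \<diamondop> word v) = mult (eval a (word u)) (eval a (word v))" for u v
    unfolding diamond_word
    by (induction u v rule: diamond_word.induct)
       (simp_all add: eval_word mult_one_left mult_one_right eval_times_D eval_times_Y eval_simps
         mult_assoc mult_left_commute der_mult)
qed

text \<open>
  By multiplicativity the kernel of an evaluation is an ideal; the generators lie in it because
  the target satisfies the Leibniz rule.
\<close>

lemma eval_L_minus:
  assumes "p \<in> L_minus"
  shows "eval a p = 0"
proof -
  have pow: "eval a p = 0 \<Longrightarrow> eval a (d\<^sub>L ^ k * p) = 0" for k p
    by (induction k) (simp_all add: mult.assoc eval_times_D qlinear_zero[OF der_linear])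
  have "diamond_ideal {p. eval a p = 0}"
    unfolding diamond_ideal_def
    by (auto intro!: rat_vec.subspaceI simp: eval_simps eval_diamond mult_simps)
  moreover have "L_minus_gens \<subseteq> {p. eval a p = 0}"
    unfolding L_minus_gens_def
    by (auto intro!: pow simp: eval_simps eval_diamond eval_times_D der_mult)
  ultimately show ?thesis
    using L_minus_least assms by blast
qed

lemma eval_cong: "H0_rel p q \<Longrightarrow> eval a p = eval a q"
  using eval_L_minus[of "p - q" a] by (simp add: H0_rel_iff eval_simps)

lemma commutative_differential_algebra_tensor:
  "commutative_differential_algebra (tmult mult mult) (one \<otimes> one) (tleibniz der)"
proof (intro commutative_differential_algebra.intro unital_algebra.intro
      commutative_differential_algebra_axioms.intro)
  note M = mult_bilinear
  note T = qbilinear_tmult[OF M M]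
  note L = qlinear_tleibniz[OF der_linear]
  note S = tmult_tensor[OF M M] qbilinear_simps[OF T] qlinear_simps[OF L] tleibniz_tensor[OF der_linear]
  show "qbilinear (tmult mult mult)" by (rule T)
  show "qlinear (tleibniz der)" by (rule L)
  fix x y z :: "('h, 'h) tensor"
  show "tmult mult mult (tmult mult mult x y) z = tmult mult mult x (tmult mult mult y z)"
    by (rule tmult_assoc) (simp_all add: M mult_assoc)
  show "tmult mult mult (one \<otimes> one) x = x"
    by (induction x rule: tensor_induct) (simp_all add: S mult_one_left)
  show "tmult mult mult x (one \<otimes> one) = x"
    by (induction x rule: tensor_induct) (simp_all add: S mult_one_right)
  have "tmult mult mult (a \<otimes> b) y = tmult mult mult y (a \<otimes> b)" for a b
    by (induction y rule: tensor_induct) (simp_all add: S mult_commute)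
  then show "tmult mult mult x y = tmult mult mult y x"
    by (induction x rule: tensor_induct) (simp_all add: S)
  have "tleibniz der (tmult mult mult (a \<otimes> b) y) =
      tmult mult mult (tleibniz der (a \<otimes> b)) y + tmult mult mult (a \<otimes> b) (tleibniz der y)" for a b
    by (induction y rule: tensor_induct) (simp_all add: S der_mult)
  then show "tleibniz der (tmult mult mult x y) =
      tmult mult mult (tleibniz der x) y + tmult mult mult x (tleibniz der y)"
    by (induction x rule: tensor_induct) (simp_all add: S)
qed

lemma tleibniz_mult:
  "tleibniz (mult a) t = tmult mult mult (one \<otimes> a + a \<otimes> one) t"
  by (induction t rule: tensor_induct)
     (simp_all add: qlinear_simps[OF qlinear_tleibniz] qbilinearD(1) mult_bilinear tleibniz_tensor
       tmult_tensor qbilinear_simps[OF qbilinear_tmult] mult_one_left algebra_simps)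

end

global_interpretation H0: commutative_differential_algebra mult_H0 one_H0 der_H0
  by (intro commutative_differential_algebra.intro unital_algebra.intro
      commutative_differential_algebra_axioms.intro)
     (rule qbilinear_mult_H0 mult_H0_assoc mult_H0_one_left mult_H0_one_right mult_H0_commute
       qlinear_der_H0 der_H0_mult)+

global_interpretation H0_tensor:
  commutative_differential_algebra "tmult mult_H0 mult_H0" "one_H0 \<otimes> one_H0" "tleibniz der_H0"
  by (rule H0.commutative_differential_algebra_tensor)

global_interpretation trivial_rat: commutative_differential_algebra "(*)" "1 :: rat" "\<lambda>_. 0"
  by unfold_locales (auto intro!: qbilinearI qlinearI simp: algebra_simps)


section \<open>Coproduct, counit and antipode\<close>

text \<open>
  Primitivity of the letters in operator form, in which it survives the passage to the quotient:
  there \<open>d\<close> is only an operator, the class of the word \<open>d\<close> being zero.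
\<close>

lemma coproduct0_times_letter: "coproduct0 (word [x] * p) = tleibniz ((*) (word [x])) (coproduct0 p)"
proof -
  have "tmult (*) (*) (1 \<otimes> word [x] + word [x] \<otimes> 1) t = tleibniz ((*) (word [x])) t" for t
    by (induction t rule: tensor_induct)
       (simp_all add: qlinear_simps[OF qlinear_tleibniz] qbilinearD(1) qbilinear_times tleibniz_tensor
         tmult_tensor qbilinear_simps[OF qbilinear_tmult] algebra_simps)
  then show ?thesis
    by (simp add: coproduct0_mult coproduct0_letter)
qed

lemma coproduct0_eval:
  "tmap abs_H0 abs_H0 (coproduct0 p) = H0_tensor.eval (one_H0 \<otimes> y_H0 + y_H0 \<otimes> one_H0) p"
proof (rule H0_tensor.eval_unique[where f = "\<lambda>p. tmap abs_H0 abs_H0 (coproduct0 p)"])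
  note lin = qlinear_abs_H0 qbilinearD(1)[OF qbilinear_times] qlinear_der_H0
    qbilinearD(1)[OF qbilinear_mult_H0]
  show "qlinear (\<lambda>p. tmap abs_H0 abs_H0 (coproduct0 p))"
    by (intro qlinear_comp[OF qlinear_tmap] lin) (simp add: coproduct0_def[abs_def])
  show "tmap abs_H0 abs_H0 (coproduct0 1) = one_H0 \<otimes> one_H0"
    by (simp add: coproduct0_one tmap_tensor qlinear_abs_H0)
  show "tmap abs_H0 abs_H0 (coproduct0 (d\<^sub>L * p)) = tleibniz der_H0 (tmap abs_H0 abs_H0 (coproduct0 p))" for p
    unfolding coproduct0_times_letter
    by (rule tmap_tleibniz) (simp_all add: lin der_H0.abs_eq)
  show "tmap abs_H0 abs_H0 (coproduct0 (y\<^sub>L * p)) =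
      tmult mult_H0 mult_H0 (one_H0 \<otimes> y_H0 + y_H0 \<otimes> one_H0) (tmap abs_H0 abs_H0 (coproduct0 p))" for p
    unfolding coproduct0_times_letter H0.tleibniz_mult[symmetric]
    by (rule tmap_tleibniz) (simp_all add: lin mult_y_H0)
qed

lemma counit0_eval: "counit0 p = trivial_rat.eval 0 p"
proof (rule qlinear_word_eqI[OF _ trivial_rat.qlinear_eval])
  show "qlinear counit0"
    by (rule qlinearI) (simp_all add: counit0_def lookup_add)
  show "counit0 (word w) = trivial_rat.eval 0 (word w)" for w
    by (induction w rule: word_induct)
       (simp_all add: trivial_rat.eval_word counit0_def, simp_all add: word_def lookup_single)
qed

lift_definition comult_H0 :: "H0 \<Rightarrow> (H0, H0) tensor"
  is "\<lambda>p. tmap abs_H0 abs_H0 (coproduct0 p)"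
  unfolding coproduct0_eval by (rule H0_tensor.eval_cong)

lift_definition counit_H0 :: "H0 \<Rightarrow> rat" is counit0
  unfolding counit0_eval by (rule trivial_rat.eval_cong)

lift_definition antipode_H0 :: "H0 \<Rightarrow> H0" is "H0.eval (- y_H0)"
  by (rule H0.eval_cong)

context commutative_differential_algebra
begin

text \<open>
  An evaluation that has been factored through the quotient is a homomorphism of differential
  algebras sending \<open>y\<close> to \<open>a\<close>. The coproduct, the counit and the antipode are all of this form.
\<close>

lemma eval_quotient_map:
  assumes f: "\<And>p. f (abs_H0 p) = eval a p"
  shows "qlinear f" "f (mult_H0 x z) = mult (f x) (f z)" "f one_H0 = one"
    "f (der_H0 x) = der (f x)" "f (mult_H0 y_H0 x) = mult a (f x)"
proof -
  show "qlinear f"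
  proof (rule qlinearI)
    fix x y :: H0 and c :: rat
    obtain p q where "x = abs_H0 p" "y = abs_H0 q"
      by (metis H0_cases)
    then show "f (x + y) = f x + f y" "f (c *\<^sub>Q x) = c *\<^sub>Q f x"
      by (simp_all add: plus_H0.abs_eq scaleQ_H0.abs_eq f eval_simps)
  qed
  obtain p q where "x = abs_H0 p" "z = abs_H0 q"
    by (metis H0_cases)
  then show "f (mult_H0 x z) = mult (f x) (f z)" "f one_H0 = one"
    "f (der_H0 x) = der (f x)" "f (mult_H0 y_H0 x) = mult a (f x)"
    by (simp_all only: f mult_H0.abs_eq[of p q] eval_diamond eval_one der_H0.abs_eq eval_times_D
        mult_y_H0 eval_times_Y)
qed

end

lemmas comult_H0 = H0_tensor.eval_quotient_map[OF comult_H0.abs_eq[unfolded coproduct0_eval]]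
lemmas counit_H0 = trivial_rat.eval_quotient_map[OF counit_H0.abs_eq[unfolded counit0_eval]]
lemmas antipode_H0 = H0.eval_quotient_map[OF antipode_H0.abs_eq]

lemma comult_H0_leibniz:
  "comult_H0 (der_H0 x) = tleibniz der_H0 (comult_H0 x)"
  "comult_H0 (mult_H0 y_H0 x) = tleibniz (mult_H0 y_H0) (comult_H0 x)"
  by (simp_all only: comult_H0(4,5) H0.tleibniz_mult)

lemma counit_H0_y: "counit_H0 (mult_H0 y_H0 x) = 0"
  by (simp only: counit_H0(5) mult_zero_left)

lemmas letters_linear = qlinear_der_H0 qbilinearD(1)[OF qbilinear_mult_H0]

lemma coassoc_H0: "tassoc (tmap comult_H0 id (comult_H0 x)) = tmap id comult_H0 (comult_H0 x)"
proof (induction x rule: H0_induct)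
  case one
  then show ?case
    by (simp add: comult_H0(1,3) tmap_tensor qlinear_id qlinear_ident tassoc_tensor)
next
  case (der a)
  show ?case
    by (rule coassoc_tleibniz[OF _ _ _ der]) (simp_all add: comult_H0_leibniz comult_H0(1) letters_linear)
next
  case (y a)
  show ?case
    by (rule coassoc_tleibniz[OF _ _ _ y]) (simp_all add: comult_H0_leibniz comult_H0(1) letters_linear)
qed (simp_all add: qlinear_simps[OF comult_H0(1)] qlinear_simps[OF qlinear_tmap] qlinear_id qlinear_ident
      comult_H0(1) qlinear_simps[OF qlinear_tassoc])

lemmas qbilinear_counit = qbilinear_scale_functional[OF counit_H0(1)]

lemma counit_comult_H0:
  "tlift (\<lambda>a b. counit_H0 a *\<^sub>Q b) (comult_H0 x) = x"
  "tlift (\<lambda>a b. counit_H0 b *\<^sub>Q a) (comult_H0 x) = x"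
proof (induction x rule: H0_induct)
  case one
  show "tlift (\<lambda>a b. counit_H0 a *\<^sub>Q b) (comult_H0 one_H0) = one_H0"
    "tlift (\<lambda>a b. counit_H0 b *\<^sub>Q a) (comult_H0 one_H0) = one_H0"
    by (simp_all add: comult_H0 tlift_tensor qbilinear_counit counit_H0 scaleQ_one)
qed (simp_all add: comult_H0_leibniz counit_tleibniz counit_H0(1,4) counit_H0_y letters_linear
      qlinear_simps[OF comult_H0(1)] qlinear_simps[OF qlinear_tlift] qbilinear_counit)

text \<open>
  For \<open>m\<close> the product with an antipode applied to either factor, this is one side of the antipode
  axiom. The derivation can be pulled out of the convolution, which is then a derivative of a
  multiple of the unit and hence zero; a factor \<open>y\<close> contributes \<open>(- y) + y = 0\<close>. So both sides
  vanish on everything that comes from a nonempty word.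
\<close>

lemma convolution_eq_counit:
  assumes m: "qbilinear m" "m one_H0 one_H0 = one_H0"
    and der: "\<And>a b. m (der_H0 a) b + m a (der_H0 b) = der_H0 (m a b)"
    and y: "\<And>a b. m (mult_H0 y_H0 a) b + m a (mult_H0 y_H0 b) = 0"
  shows "tlift m (comult_H0 x) = counit_H0 x *\<^sub>Q one_H0"
proof -
  note lift = qlinear_simps[OF qlinear_tlift[OF m(1)]] tlift_tensor[OF m(1)]
  have D: "tlift m (tleibniz der_H0 t) = der_H0 (tlift m t)" for t
    by (induction t rule: tensor_induct)
       (simp_all add: lift qlinear_simps[OF qlinear_tleibniz[OF qlinear_der_H0]]
         qlinear_simps[OF qlinear_der_H0] tleibniz_tensor qlinear_der_H0 der)
  have Y: "tlift m (tleibniz (mult_H0 y_H0) t) = 0" for t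
    by (induction t rule: tensor_induct)
       (simp_all add: lift qlinear_simps[OF qlinear_tleibniz[OF letters_linear(2)]]
         tleibniz_tensor letters_linear y)
  show ?thesis
    by (induction x rule: H0_induct)
       (simp_all add: comult_H0_leibniz D Y comult_H0(1,3) qlinear_simps[OF comult_H0(1)]
         qlinear_simps[OF counit_H0(1)] lift m(2) counit_H0(3,4) counit_H0_y scaleQ_add_left
         scaleQ_scaleQ scaleQ_one qlinear_simps[OF qlinear_der_H0] H0.der_one)
qed

lemma mult_H0_minus_left: "mult_H0 (- a) b = - mult_H0 a b"
  using qbilinear_diff_left[OF qbilinear_mult_H0, of 0 a b] by (simp add: mult_H0_simps)

lemma mult_H0_minus_right: "mult_H0 a (- b) = - mult_H0 a b"
  using qbilinear_diff_right[OF qbilinear_mult_H0, of a 0 b] by (simp add: mult_H0_simps)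

lemma antipode_mult_y: "antipode_H0 (mult_H0 y_H0 a) = - mult_H0 y_H0 (antipode_H0 a)"
  by (simp only: antipode_H0(5) mult_H0_minus_left)

lemma antipode_left: "tlift (\<lambda>a b. mult_H0 (antipode_H0 a) b) (comult_H0 x) = counit_H0 x *\<^sub>Q one_H0"
  using qbilinear_comp[OF qbilinear_mult_H0 antipode_H0(1) qlinear_ident qlinear_ident]
  by (rule convolution_eq_counit)
     (simp_all add: antipode_H0(3,4) antipode_mult_y mult_H0_one_left der_H0_mult
       mult_H0_minus_left mult_H0_y_left mult_H0_y_right)

lemma antipode_right: "tlift (\<lambda>a b. mult_H0 a (antipode_H0 b)) (comult_H0 x) = counit_H0 x *\<^sub>Q one_H0"
  using qbilinear_comp[OF qbilinear_mult_H0 qlinear_ident antipode_H0(1) qlinear_ident]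
  by (rule convolution_eq_counit)
     (simp_all add: antipode_H0(3,4) antipode_mult_y mult_H0_one_left der_H0_mult
       mult_H0_minus_right mult_H0_y_left mult_H0_y_right)

theorem corollary3p22:
  shows "\<exists>(mult :: H0 \<Rightarrow> H0 \<Rightarrow> H0) (comult :: H0 \<Rightarrow> (H0, H0) tensor) (counit :: H0 \<Rightarrow> rat).
    (\<forall>a b. mult (abs_H0 a) (abs_H0 b) = abs_H0 (a \<diamondop> b)) \<and>
    (\<forall>a. comult (abs_H0 a) = tmap abs_H0 abs_H0 (coproduct0 a)) \<and>
    (\<forall>a. counit (abs_H0 a) = counit0 a) \<and>
    commutative_hopf_algebra mult (abs_H0 1) comult counit"
proof (intro exI conjI allI)
  show "mult_H0 (abs_H0 a) (abs_H0 b) = abs_H0 (a \<diamondop> b)" for a b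
    by (rule mult_H0.abs_eq)
  show "comult_H0 (abs_H0 a) = tmap abs_H0 abs_H0 (coproduct0 a)" for a
    by (rule comult_H0.abs_eq)
  show "counit_H0 (abs_H0 a) = counit0 a" for a
    by (rule counit_H0.abs_eq)
  show "commutative_hopf_algebra mult_H0 one_H0 comult_H0 counit_H0"
  proof (intro commutative_hopf_algebra.intro hopf_algebra.intro bialgebra.intro
      commutative_hopf_algebra_axioms.intro hopf_algebra_axioms.intro bialgebra_axioms.intro
      coalgebra.intro)
    show "unital_algebra mult_H0 one_H0"
      by (rule H0.unital_algebra_axioms)
    show "\<exists>S. qlinear S \<and>
        (\<forall>x. tlift (\<lambda>a b. mult_H0 (S a) b) (comult_H0 x) = counit_H0 x *\<^sub>Q one_H0) \<and>
        (\<forall>x. tlift (\<lambda>a b. mult_H0 a (S b)) (comult_H0 x) = counit_H0 x *\<^sub>Q one_H0)"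
      using antipode_H0(1) antipode_left antipode_right by blast
  qed (rule comult_H0 counit_H0 coassoc_H0 counit_comult_H0 mult_H0_commute)+
qed

end
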